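(* Let $F$ be a free group and let $H$ be a finitely generated subgroup of $F$ with infinite index $[F:H]$. Then there is a nontrivial normal subgroup $N$ of $F$ such that $N\cap H=\{1\}$. *)

theory Defs
  imports "HOL-Algebra.Generated_Groups"
begin

text \<open>
  A letter \<open>(x, True)\<close> stands for \<open>x\<close> and \<open>(x, False)\<close> for the formal inverse of \<open>x\<close>.
\<close>

type_synonym 'a word = "('a \<times> bool) list"

definition reduced :: "'a word \<Rightarrow> bool" where
  "reduced w \<longleftrightarrow> successively (\<lambda>(x, a) (y, b). \<not> (x = y \<and> a \<noteq> b)) w"

definition reduced_words :: "'a set \<Rightarrow> 'a word set" where
  "reduced_words B = {w. reduced w \<and> fst ` set w \<subseteq> B}"

fun word_eval :: "('a, 'b) monoid_scheme \<Rightarrow> 'a word \<Rightarrow> 'a" where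
  "word_eval G [] = \<one>\<^bsub>G\<^esub>"
| "word_eval G ((x, a) # w) = (if a then x else inv\<^bsub>G\<^esub> x) \<otimes>\<^bsub>G\<^esub> word_eval G w"

text \<open>
  \<open>B\<close> is a basis of \<open>G\<close> if every element of \<open>G\<close> is the value of exactly one reduced word
  over \<open>B\<close>. The basis may have any cardinality; the trivial group is free on the empty set.
\<close>

definition free_basis :: "('a, 'b) monoid_scheme \<Rightarrow> 'a set \<Rightarrow> bool" where
  "free_basis G B \<longleftrightarrow>
     B \<subseteq> carrier G \<and> (\<forall>g \<in> carrier G. \<exists>!w. w \<in> reduced_words B \<and> word_eval G w = g)"

definition free_group :: "('a, 'b) monoid_scheme \<Rightarrow> bool" where
  "free_group G \<longleftrightarrow> group G \<and> (\<exists>B. free_basis G B)"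

definition finitely_generated_subgroup :: "'a set \<Rightarrow> ('a, 'b) monoid_scheme \<Rightarrow> bool" where
  "finitely_generated_subgroup H G \<longleftrightarrow>
     subgroup H G \<and> (\<exists>S. finite S \<and> S \<subseteq> carrier G \<and> H = generate G S)"

end

theory Submission
  imports Defs
begin

text \<open>
  Let \<open>Y\<close> be the union of the cosets of \<open>H\<close> visited by words for the finitely many generators
  of \<open>H\<close>. Right multiplication by a basis element \<open>x\<close> is only a partial injection of \<open>Y\<close>. It is
  completed to a permutation of \<open>Y \<times> {+, -}\<close> which moves by \<open>x\<close> on the positive sheet, by
  \<open>x\<inverse>\<close> on the negative sheet, and changes the sheet where such a move would leave \<open>Y\<close>. By
  freeness this defines an action of \<open>F\<close>, and an element \<open>h\<close> of \<open>H\<close> moves \<open>(1, +)\<close> to \<open>(h, +)\<close>,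
  so its kernel \<open>N\<close> meets \<open>H\<close> trivially.

  \<open>N\<close> is nontrivial: the action commutes with left multiplication by \<open>H\<close>, which has only finitely
  many orbits, so some power \<open>x\<^sup>n\<close> of each basis element preserves all \<open>H\<close>-orbits. As the index
  is infinite, every point can be moved by some \<open>u\<close> to a point where a letter \<open>x\<close> leaves \<open>Y\<close>; the
  \<open>x\<close>-orbit of that point runs back and forth along a finite path, hence is fixed by \<open>x\<^sup>n\<close>, and
  \<open>u x\<^sup>n u\<inverse>\<close> fixes the given point. Commutators of conjugates of such elements combine these
  stabilizers over representatives of all \<open>H\<close>-orbits.
\<close>

section \<open>Free groups\<close>

text \<open>The product is composition in diagrammatic order, so that homomorphisms into this group are
  right actions.\<close>

definition perm_group :: "('p \<Rightarrow> 'p) monoid" where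
  "perm_group = \<lparr>carrier = {f. bij f}, monoid.mult = (\<lambda>f g. g \<circ> f), one = id\<rparr>"

lemma group_perm_group: "group (perm_group :: ('p \<Rightarrow> 'p) monoid)"
proof (rule groupI)
  fix f :: "'p \<Rightarrow> 'p" assume "f \<in> carrier perm_group"
  then have "bij f" by (simp add: perm_group_def)
  then show "\<exists>g\<in>carrier perm_group. g \<otimes>\<^bsub>perm_group\<^esub> f = \<one>\<^bsub>perm_group\<^esub>"
    by (intro bexI[of _ "inv_into UNIV f"])
       (auto simp: perm_group_def bij_imp_bij_inv surj_iff[THEN iffD1, OF bij_is_surj])
qed (auto simp: perm_group_def bij_comp o_assoc intro: bij_comp)

section \<open>Words, their values and reduction\<close>

lemma (in group) word_eval_closed:
  "fst ` set w \<subseteq> carrier G \<Longrightarrow> word_eval G w \<in> carrier G"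
  by (induction w) (auto split: if_splits)

lemma (in group) word_eval_append:
  assumes "fst ` set v \<subseteq> carrier G" "fst ` set w \<subseteq> carrier G"
  shows "word_eval G (v @ w) = word_eval G v \<otimes> word_eval G w"
  using assms
proof (induction v)
  case Nil
  then show ?case by (simp add: word_eval_closed)
next
  case (Cons l v)
  then show ?case by (cases l) (auto simp: word_eval_closed m_assoc)
qed

lemma reduced_Nil [simp]: "reduced []"
  by (simp add: reduced_def)

lemma reduced_Cons:
  "reduced ((x, a) # w) \<longleftrightarrow> reduced w \<and> (w = [] \<or> hd w \<noteq> (x, \<not> a))"
  by (cases w) (auto simp: reduced_def)

lemma reduced_append:
  "reduced (v @ w) \<longleftrightarrow> reduced v \<and> reduced w \<and>
     (v = [] \<or> w = [] \<or> hd w \<noteq> map_prod id Not (last v))"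
  by (cases "hd w"; cases "last v") (auto simp: reduced_def successively_append_iff)

lemma reduced_replicate: "reduced (replicate n l)"
  by (cases l) (auto simp: reduced_def successively_conv_nth)

lemma (in group) inv_mult_cancel_left:
  "x \<in> carrier G \<Longrightarrow> z \<in> carrier G \<Longrightarrow> inv x \<otimes> (x \<otimes> z) = z"
  "x \<in> carrier G \<Longrightarrow> z \<in> carrier G \<Longrightarrow> x \<otimes> (inv x \<otimes> z) = z"
  by (simp_all flip: m_assoc)

text \<open>One reduction serves both evaluations, so the value of a word under \<open>f\<close> depends only on
  its value in \<open>G\<close>.\<close>

lemma ex_reduced_word:
  assumes "group G" "group K" "B \<subseteq> carrier G" "f \<in> B \<rightarrow> carrier K" "fst ` set w \<subseteq> B"
  shows "\<exists>v \<in> reduced_words B. word_eval G v = word_eval G w \<and>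
           word_eval K (map (apfst f) v) = word_eval K (map (apfst f) w)"
  using assms(5)
proof (induction w)
  case Nil
  then show ?case by (intro bexI[of _ "[]"]) (auto simp: reduced_words_def)
next
  case (Cons l w)
  interpret G: group G by fact
  interpret K: group K by fact
  obtain x a where l: "l = (x, a)" by force
  from Cons l have x: "x \<in> B" "x \<in> carrier G" "f x \<in> carrier K" using assms by auto
  obtain v where v: "v \<in> reduced_words B" "word_eval G v = word_eval G w"
    "word_eval K (map (apfst f) v) = word_eval K (map (apfst f) w)"
    using Cons.IH by (metis image_subset_iff list.set_intros(2) Cons.prems)
  show ?case
  proof (cases "v = [] \<or> hd v \<noteq> (x, \<not> a)")
    case True
    with v l x show ?thesis
      by (intro bexI[of _ "l # v"]) (auto simp: reduced_words_def reduced_Cons)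
  next
    case False
    then obtain u where u: "v = (x, \<not> a) # u" by (cases v) auto
    with v have ur: "u \<in> reduced_words B"
      by (auto simp: reduced_words_def reduced_Cons)
    have "fst ` set u \<subseteq> carrier G" "fst ` set (map (apfst f) u) \<subseteq> carrier K"
      using ur assms by (fastforce simp: reduced_words_def)+
    then have uc: "word_eval G u \<in> carrier G" "word_eval K (map (apfst f) u) \<in> carrier K"
      by (simp_all only: G.word_eval_closed K.word_eval_closed)
    show ?thesis
    proof (intro bexI[of _ u] conjI ur)
      show "word_eval G u = word_eval G (l # w)"
        unfolding l word_eval.simps v(2)[symmetric] using u uc x
        by (simp add: G.inv_mult_cancel_left)
      show "word_eval K (map (apfst f) u) = word_eval K (map (apfst f) (l # w))"
        unfolding l list.map apfst_conv word_eval.simps v(3)[symmetric] using u uc x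
        by (simp add: K.inv_mult_cancel_left)
    qed
  qed
qed

section \<open>Free bases and their universal property\<close>

locale free_group_on = group F for F :: "('a, 'b) monoid_scheme" (structure) +
  fixes B
  assumes basis: "free_basis F B"
begin

lemma basis_subset: "B \<subseteq> carrier F"
  using basis by (simp add: free_basis_def)

lemma basis_closed [simp]: "x \<in> B \<Longrightarrow> x \<in> carrier F"
  using basis_subset by auto

lemma obtain_word:
  assumes "g \<in> carrier F"
  obtains w where "w \<in> reduced_words B" "word_eval F w = g"
  using basis assms unfolding free_basis_def by blast

lemma word_eval_inject:
  assumes "v \<in> reduced_words B" "w \<in> reduced_words B" "word_eval F v = word_eval F w"
  shows "v = w"
proof -
  have "word_eval F v \<in> carrier F"
    using assms basis_subset by (intro word_eval_closed) (auto simp: reduced_words_def)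
  then show ?thesis using basis assms unfolding free_basis_def by metis
qed

text \<open>Letters are split off on the left, the side that acts first in a right action. The words
  need not be reduced, so no side condition on cancellation enters.\<close>

lemma basis_induct [consumes 1, case_names one gen inv]:
  assumes "z \<in> carrier F" and "P \<one>"
    and "\<And>x z. x \<in> B \<Longrightarrow> z \<in> carrier F \<Longrightarrow> P z \<Longrightarrow> P (x \<otimes> z)"
    and "\<And>x z. x \<in> B \<Longrightarrow> z \<in> carrier F \<Longrightarrow> P z \<Longrightarrow> P (inv x \<otimes> z)"
  shows "P z"
proof -
  obtain w where "w \<in> reduced_words B" "word_eval F w = z" using assms(1) by (rule obtain_word)
  moreover have "P (word_eval F w)" if "fst ` set w \<subseteq> B"
    using that
  proof (induction w)
    case (Cons l w)
    moreover have "word_eval F w \<in> carrier F"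
      using Cons.prems by (intro word_eval_closed) auto
    ultimately show ?case using assms(3,4) by (cases l) auto
  qed (simp add: assms(2))
  ultimately show ?thesis by (auto simp: reduced_words_def)
qed

text \<open>\<open>\<phi> g\<close> evaluates in \<open>K\<close> an arbitrary word for
  \<open>g\<close>. Two words with the same value in \<open>F\<close> reduce to the same word by
  \<open>ex_reduced_word\<close> and uniqueness, so the choice does not matter. Admitting unreduced
  words makes multiplicativity a matter of concatenation.\<close>

lemma universal_property:
  assumes "group K" and f: "f \<in> B \<rightarrow> carrier K"
  shows "\<exists>\<phi> \<in> hom F K. \<forall>x\<in>B. \<phi> x = f x"
proof -
  interpret K: group K by fact
  define ev where "ev w = word_eval K (map (apfst f) w)" for w
  define \<phi> where "\<phi> g = ev (SOME w. fst ` set w \<subseteq> B \<and> word_eval F w = g)" for g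
  have ev_eq: "ev v = ev w"
    if vw: "fst ` set v \<subseteq> B" "fst ` set w \<subseteq> B" "word_eval F v = word_eval F w" for v w
  proof -
    obtain v' where "v' \<in> reduced_words B" "word_eval F v' = word_eval F v" "ev v' = ev v"
      using ex_reduced_word[OF is_group assms(1) basis_subset f vw(1)] unfolding ev_def by auto
    moreover obtain w' where "w' \<in> reduced_words B" "word_eval F w' = word_eval F w" "ev w' = ev w"
      using ex_reduced_word[OF is_group assms(1) basis_subset f vw(2)] unfolding ev_def by auto
    ultimately show ?thesis using vw(3) word_eval_inject by metis
  qed
  have \<phi>_eval: "\<phi> (word_eval F w) = ev w" if "fst ` set w \<subseteq> B" for w
  proof -
    have "fst ` set (SOME v. fst ` set v \<subseteq> B \<and> word_eval F v = word_eval F w) \<subseteq> B \<and>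
      word_eval F (SOME v. fst ` set v \<subseteq> B \<and> word_eval F v = word_eval F w) = word_eval F w"
      by (rule someI[of _ w]) (simp add: that)
    then show ?thesis unfolding \<phi>_def using ev_eq that by blast
  qed
  have letters: "fst ` set (map (apfst f) w) \<subseteq> carrier K" if "fst ` set w \<subseteq> B" for w
    using that f by fastforce
  have "\<phi> \<in> hom F K"
  proof (rule homI)
    fix g assume "g \<in> carrier F"
    then obtain w where w: "w \<in> reduced_words B" "word_eval F w = g" by (rule obtain_word)
    then have "fst ` set w \<subseteq> B" by (simp add: reduced_words_def)
    then show "\<phi> g \<in> carrier K"
      using \<phi>_eval[of w] w letters[of w] unfolding ev_def by (metis K.word_eval_closed)
    fix h assume "h \<in> carrier F"
    then obtain v where v: "v \<in> reduced_words B" "word_eval F v = h" by (rule obtain_word)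
    then have "fst ` set v \<subseteq> B" by (simp add: reduced_words_def)
    note sub = \<open>fst ` set w \<subseteq> B\<close> \<open>fst ` set v \<subseteq> B\<close>
    have "g \<otimes> h = word_eval F (w @ v)"
      using sub basis_subset w v by (subst word_eval_append) auto
    moreover have "ev (w @ v) = ev w \<otimes>\<^bsub>K\<^esub> ev v"
      unfolding ev_def map_append using letters sub by (intro K.word_eval_append) auto
    ultimately show "\<phi> (g \<otimes> h) = \<phi> g \<otimes>\<^bsub>K\<^esub> \<phi> h"
      using \<phi>_eval[of "w @ v"] \<phi>_eval[of w] \<phi>_eval[of v] sub w v by (simp add: image_Un)
  qed
  moreover have "\<phi> x = f x" if "x \<in> B" for x
    using \<phi>_eval[of "[(x, True)]"] that funcset_mem[OF f that] by (simp add: ev_def)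
  ultimately show ?thesis by blast
qed

section \<open>Powers of letters and conjugation without cancellation\<close>

definition letter :: "'a \<times> bool \<Rightarrow> 'a" where
  "letter l = (if snd l then fst l else inv (fst l))"

lemma letter_closed [simp]: "fst l \<in> B \<Longrightarrow> letter l \<in> carrier F"
  by (simp add: letter_def)

lemma word_eval_replicate:
  assumes "fst l \<in> B"
  shows "word_eval F (replicate n l) = letter l [^] n"
proof (induction n)
  case (Suc n)
  have "word_eval F (replicate (Suc n) l) = letter l \<otimes> letter l [^] n"
    using Suc by (cases l) (simp add: letter_def)
  also have "\<dots> = letter l [^] Suc n"
    using assms by (intro nat_pow_Suc2[symmetric]) simp
  finally show ?case .
qed simp

lemma pow_basis_neq_one:
  assumes "x \<in> B" "n > 0"
  shows "x [^] (n::nat) \<noteq> \<one>"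
proof
  assume "x [^] n = \<one>"
  then have "word_eval F (replicate n (x, True)) = word_eval F []"
    using assms by (simp add: word_eval_replicate letter_def)
  then have "replicate n (x, True) = []"
    using assms by (intro word_eval_inject) (auto simp: reduced_words_def reduced_replicate)
  with assms show False by simp
qed

text \<open>Two nontrivial elements may commute, but conjugation by powers of well-chosen letters
  destroys this. The conjugators are \<open>n\<close>-th powers so that, for
  \<open>n = exponent\<close>, they lie in \<open>coset_kernel\<close> and preserve the stabilizers
  used later.\<close>

lemma ex_noncommuting_conjugates:
  assumes xy: "x \<in> B" "y \<in> B" "x \<noteq> y" and n: "n > 0"
    and a: "a \<in> carrier F" "a \<noteq> \<one>" and b: "b \<in> carrier F" "b \<noteq> \<one>"
  obtains p q where "fst p \<in> B" "fst q \<in> B"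
    "(letter p [^] (n::nat) \<otimes> a \<otimes> inv (letter p [^] n)) \<otimes>
       (letter q [^] n \<otimes> b \<otimes> inv (letter q [^] n)) \<noteq>
     (letter q [^] n \<otimes> b \<otimes> inv (letter q [^] n)) \<otimes>
       (letter p [^] n \<otimes> a \<otimes> inv (letter p [^] n))"
proof -
  obtain u where u: "u \<in> reduced_words B" "word_eval F u = a" using a(1) by (rule obtain_word)
  obtain v where v: "v \<in> reduced_words B" "word_eval F v = b" using b(1) by (rule obtain_word)
  have ne: "u \<noteq> []" "v \<noteq> []" using u v a b by auto
  let ?flip = "map_prod id Not :: 'a \<times> bool \<Rightarrow> _"
  let ?L = "{x, y} \<times> (UNIV :: bool set)"
  \<comment> \<open>Two basis elements give four letters, one more than the number of letters ever
    to be avoided.\<close>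
  have avoid: "\<exists>p \<in> ?L. p \<notin> {r, s, t}" for r s t
  proof (rule ccontr)
    assume "\<not> ?thesis"
    then have "?L \<subseteq> {r, s, t}" by blast
    then have "card ?L \<le> card {r, s, t}" by (intro card_mono) auto
    also have "\<dots> \<le> 3" by (simp add: card_insert_if)
    finally show False using xy by (simp add: card_cartesian_product)
  qed
  \<comment> \<open>The two conditions on \<open>q\<close> rule out cancellation on either side of
    \<open>v\<close> in \<open>q^n v q^-n\<close>. The same is done for \<open>p\<close> and
    \<open>u\<close>; \<open>p \<noteq> q\<close> rules out cancellation between the two
    conjugates.\<close>
  obtain q where q: "q \<in> ?L" "q \<noteq> ?flip (hd v)" "q \<noteq> last v"
    using avoid[of "?flip (hd v)" "last v" "last v"] by auto
  obtain p where p: "p \<in> ?L" "p \<noteq> ?flip (hd u)" "p \<noteq> last u" "p \<noteq> q"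
    using avoid[of "?flip (hd u)" "last u" q] by auto
  have flip2: "?flip (?flip l) = l" for l by (cases l) simp
  have flip_neq: "?flip l = ?flip m \<longleftrightarrow> l = m" for l m by (cases l; cases m) auto
  have in_B: "fst p \<in> B" "fst q \<in> B" using p q xy by auto
  \<comment> \<open>The bordering letters make \<open>W p u W q v\<close> and \<open>W q v W p u\<close> reduced words with different first
    letters.\<close>
  define W where "W l w = replicate n l @ w @ replicate n (?flip l)" for l w
  have W_eval: "word_eval F (W l w) = letter l [^] n \<otimes> word_eval F w \<otimes> inv (letter l [^] n)"
    if "fst l \<in> B" "w \<in> reduced_words B" for l w
  proof -
    have w: "fst ` set w \<subseteq> carrier F" using that basis_subset by (auto simp: reduced_words_def)
    have "letter (?flip l) [^] n = inv (letter l [^] n)"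
      using that by (cases l) (auto simp: letter_def nat_pow_inv)
    then show ?thesis using that w word_eval_closed[OF w] unfolding W_def
      by (subst word_eval_append word_eval_replicate; (auto simp: m_assoc)?)+
  qed
  have W_ne: "W l w \<noteq> []" "hd (W l w) = l" "last (W l w) = ?flip l" for l w
    using n by (auto simp: W_def hd_append)
  have W_red: "W l w \<in> reduced_words B"
    if "fst l \<in> B" "w \<in> reduced_words B" "w \<noteq> []" "l \<noteq> ?flip (hd w)" "l \<noteq> last w" for l w
    using that n unfolding W_def reduced_words_def
    by (auto simp: reduced_append reduced_replicate flip2 flip_neq hd_append)
  have Wu: "W p u \<in> reduced_words B" and Wv: "W q v \<in> reduced_words B"
    using W_red p q u v ne in_B by auto
  have red: "W p u @ W q v \<in> reduced_words B" "W q v @ W p u \<in> reduced_words B"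
    using Wu Wv p(4) by (auto simp: reduced_words_def reduced_append W_ne flip2)
  have "word_eval F (W p u @ W q v) \<noteq> word_eval F (W q v @ W p u)"
  proof
    assume "word_eval F (W p u @ W q v) = word_eval F (W q v @ W p u)"
    then have "hd (W p u @ W q v) = hd (W q v @ W p u)"
      using word_eval_inject red by metis
    then show False using p(4) by (simp add: W_ne)
  qed
  moreover have "fst ` set (W p u) \<subseteq> carrier F" "fst ` set (W q v) \<subseteq> carrier F"
    using Wu Wv basis_subset by (auto simp: reduced_words_def)
  ultimately show ?thesis
    using in_B u v by (intro that[of p q]) (auto simp: word_eval_append W_eval)
qed

end

section \<open>The action on a doubled union of cosets\<close>

definition flip :: "'a \<times> bool \<Rightarrow> 'a \<times> bool" where
  "flip p = (fst p, \<not> snd p)"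

text \<open>Pairs whose first component lies outside \<open>Y\<close> stay put, so that the map is a
  permutation of the whole type and not only of the doubled set.\<close>

definition shift :: "('a, 'b) monoid_scheme \<Rightarrow> 'a set \<Rightarrow> 'a \<Rightarrow> 'a \<times> bool \<Rightarrow> 'a \<times> bool" where
  "shift G Y x p =
     (let g = fst p \<otimes>\<^bsub>G\<^esub> (if snd p then x else inv\<^bsub>G\<^esub> x)
      in if fst p \<notin> Y then p else if g \<in> Y then (g, snd p) else flip p)"

lemma flip_flip [simp]: "flip (flip p) = p"
  and fst_flip [simp]: "fst (flip p) = fst p"
  and snd_flip [simp]: "snd (flip p) = (\<not> snd p)"
  by (simp_all add: flip_def)

text \<open>\<open>flip\<close> conjugates \<open>shift G Y x\<close> to its inverse: a move by
  \<open>x\<close> on one sheet is undone by the move on the other, and where the move would leave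
  \<open>Y\<close>, the same obstruction is met again on the way back.\<close>

lemma (in group) shift_flip:
  assumes "Y \<subseteq> carrier G" "x \<in> carrier G"
  shows "shift G Y x (flip (shift G Y x (flip p))) = p"
proof (cases "fst p \<in> Y")
  case True
  with assms have "fst p \<in> carrier G" by auto
  with True assms show ?thesis
    by (cases p) (auto simp: shift_def flip_def Let_def m_assoc)
qed (simp add: shift_def)

lemma (in group) bij_shift:
  assumes "Y \<subseteq> carrier G" "x \<in> carrier G"
  shows "bij (shift G Y x)"
proof (rule o_bij)
  show "shift G Y x \<circ> (\<lambda>p. flip (shift G Y x (flip p))) = id"
    using assms by (auto simp: shift_flip)
  show "(\<lambda>p. flip (shift G Y x (flip p))) \<circ> shift G Y x = id"
    using assms by (auto simp: fun_eq_iff) (metis shift_flip flip_flip)+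
qed

section \<open>The right action of \<open>F\<close> and the commuting left translations by
  \<open>H\<close>\<close>

locale coset_action = free_group_on +
  fixes H Y \<phi>
  assumes subgroup_H: "subgroup H F"
    and Y_subset: "Y \<subseteq> carrier F"
    and H_Y: "\<And>h g. h \<in> H \<Longrightarrow> g \<in> Y \<Longrightarrow> h \<otimes> g \<in> Y"
    and finite_cosets: "finite ((#>) H ` Y)"
    and infinite_index: "infinite (rcosets H)"
    and \<phi>_hom: "\<phi> \<in> hom F (perm_group :: ('a \<times> bool \<Rightarrow> 'a \<times> bool) monoid)"
    and \<phi>_basis: "x \<in> B \<Longrightarrow> \<phi> x = shift F Y x"
begin

abbreviation points :: "('a \<times> bool) set" where
  "points \<equiv> Y \<times> UNIV"

definition translate :: "'a \<Rightarrow> 'a \<times> bool \<Rightarrow> 'a \<times> bool" where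
  "translate h p = (h \<otimes> fst p, snd p)"

lemma fst_translate [simp]: "fst (translate h p) = h \<otimes> fst p"
  and snd_translate [simp]: "snd (translate h p) = snd p"
  by (simp_all add: translate_def)

lemma H_closed [simp]: "h \<in> H \<Longrightarrow> h \<in> carrier F"
  using subgroup_H by (rule subgroup.mem_carrier)

lemma H_pow: "h \<in> H \<Longrightarrow> h [^] (n::nat) \<in> H"
  by (induction n) (auto simp: subgroup.one_closed[OF subgroup_H] subgroup.m_closed[OF subgroup_H])

lemma Y_closed [simp]: "g \<in> Y \<Longrightarrow> g \<in> carrier F"
  using Y_subset by auto

lemma H_Y_iff: "h \<in> H \<Longrightarrow> g \<in> carrier F \<Longrightarrow> h \<otimes> g \<in> Y \<longleftrightarrow> g \<in> Y"
  using H_Y[of h g] H_Y[of "inv h" "h \<otimes> g"] subgroup.m_inv_closed[OF subgroup_H]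
  by (auto simp: inv_mult_cancel_left)

lemma \<phi>_mult: "a \<in> carrier F \<Longrightarrow> b \<in> carrier F \<Longrightarrow> \<phi> (a \<otimes> b) p = \<phi> b (\<phi> a p)"
  using hom_mult[OF \<phi>_hom] by (simp add: perm_group_def)

lemma \<phi>_one: "\<phi> \<one> p = p"
  using hom_one[OF \<phi>_hom is_group group_perm_group] by (simp add: perm_group_def)

lemma \<phi>_inv: "a \<in> carrier F \<Longrightarrow> \<phi> (inv a) (\<phi> a p) = p" "a \<in> carrier F \<Longrightarrow> \<phi> a (\<phi> (inv a) p) = p"
  using \<phi>_mult[of a "inv a" p] \<phi>_mult[of "inv a" a p] by (simp_all add: \<phi>_one)

lemma \<phi>_inject: "a \<in> carrier F \<Longrightarrow> \<phi> a p = \<phi> a q \<longleftrightarrow> p = q"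
  by (metis \<phi>_inv(1))

lemma \<phi>_inv_basis: "x \<in> B \<Longrightarrow> \<phi> (inv x) p = flip (shift F Y x (flip p))"
  using \<phi>_inject[of x "\<phi> (inv x) p" "flip (shift F Y x (flip p))"] \<phi>_inv(2)[of x p] Y_subset
  by (simp add: \<phi>_basis shift_flip)

lemma translate_translate:
  "h \<in> H \<Longrightarrow> k \<in> H \<Longrightarrow> p \<in> points \<Longrightarrow> translate h (translate k p) = translate (h \<otimes> k) p"
  by (cases p) (simp add: translate_def m_assoc)

lemma translate_one: "p \<in> points \<Longrightarrow> translate \<one> p = p"
  by (cases p) (simp add: translate_def)

lemma shift_points: "p \<in> points \<Longrightarrow> shift F Y x p \<in> points"
  by (cases p) (auto simp: shift_def flip_def Let_def)

lemma flip_points: "p \<in> points \<Longrightarrow> flip p \<in> points"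
  by (cases p) (auto simp: flip_def)

lemma \<phi>_points: "z \<in> carrier F \<Longrightarrow> p \<in> points \<Longrightarrow> \<phi> z p \<in> points"
proof (induction z arbitrary: p rule: basis_induct)
  case (inv x z)
  then show ?case by (simp add: \<phi>_mult \<phi>_inv_basis flip_points shift_points del: mem_Sigma_iff)
qed (auto simp: \<phi>_one \<phi>_mult \<phi>_basis shift_points simp del: mem_Sigma_iff)

lemma shift_translate:
  assumes "x \<in> carrier F" "h \<in> H" "p \<in> points"
  shows "shift F Y x (translate h p) = translate h (shift F Y x p)"
  using assms
  by (cases p) (auto simp: shift_def flip_def translate_def Let_def m_assoc H_Y_iff)

lemma flip_translate: "flip (translate h p) = translate h (flip p)"
  by (simp add: flip_def translate_def)

lemma \<phi>_translate:
  "z \<in> carrier F \<Longrightarrow> h \<in> H \<Longrightarrow> p \<in> points \<Longrightarrow> \<phi> z (translate h p) = translate h (\<phi> z p)"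
proof (induction z arbitrary: p rule: basis_induct)
  case (inv x z)
  then show ?case
    by (simp add: \<phi>_mult \<phi>_inv_basis flip_translate shift_translate flip_points shift_points
        del: mem_Sigma_iff)
qed (auto simp: \<phi>_one \<phi>_mult \<phi>_basis shift_translate shift_points simp del: mem_Sigma_iff)

section \<open>The \<open>H\<close>-orbits of points and the return times to them\<close>

definition coset_class :: "'a \<times> bool \<Rightarrow> 'a set \<times> bool" where
  "coset_class p = (H #> fst p, snd p)"

lemma finite_coset_classes: "finite (coset_class ` points)"
proof (rule finite_subset)
  show "coset_class ` points \<subseteq> ((#>) H ` Y) \<times> UNIV"
    by (auto simp: coset_class_def)
qed (simp add: finite_cosets)

lemma coset_class_eqD:
  assumes "coset_class p = coset_class q" "p \<in> points" "q \<in> points"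
  shows "\<exists>h\<in>H. q = translate h p"
proof -
  have "fst q \<in> H #> fst p"
    using assms subgroup_H by (intro repr_independenceD) (auto simp: coset_class_def)
  then show ?thesis using assms
    by (cases p; cases q) (auto simp: r_coset_def translate_def coset_class_def)
qed

text \<open>A common multiple of all return times to an \<open>H\<close>-orbit, independent of the
  element and of the point; each of them can be taken at most the number of orbits.\<close>

definition exponent :: nat where
  "exponent = fact (card (coset_class ` points))"

lemma \<phi>_pow_translate:
  assumes "z \<in> carrier F" "p \<in> points" "h \<in> H" "\<phi> z p = translate h p"
  shows "\<phi> (z [^] (n::nat)) p = translate (h [^] n) p"
proof (induction n)
  case 0
  then show ?case using assms by (simp add: \<phi>_one translate_one)
next
  case (Suc n)
  from Suc assms H_pow show ?case
    by (simp add: \<phi>_mult \<phi>_translate translate_translate)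
qed

text \<open>Pigeonhole: among the images of \<open>p\<close> under the powers \<open>0\<close> to
  \<open>?M\<close> of \<open>z\<close>, two lie in one \<open>H\<close>-orbit. Since the action
  commutes with translations, the smaller power can be cancelled, so the orbit of \<open>p\<close>
  itself is revisited.\<close>

lemma ex_pow_translate:
  assumes z: "z \<in> carrier F" and p: "p \<in> points"
  shows "\<exists>d h. d > 0 \<and> d dvd exponent \<and> h \<in> H \<and> \<phi> (z [^] d) p = translate h p"
proof -
  let ?M = "card (coset_class ` points)"
  define f where "f i = coset_class (\<phi> (z [^] i) p)" for i :: nat
  have pts: "\<phi> (z [^] i) p \<in> points" for i :: nat
    using z p by (intro \<phi>_points) auto
  have "f ` {0..?M} \<subseteq> coset_class ` points" using pts by (auto simp: f_def)
  then have "card (f ` {0..?M}) \<le> ?M" by (intro card_mono finite_coset_classes)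
  then have "\<not> inj_on f {0..?M}" using card_image[of f "{0..?M}"] by auto
  then obtain i j where ij: "i < j" "j \<le> ?M" "f i = f j"
    unfolding inj_on_def by (metis atLeastAtMost_iff nat_neq_iff)
  then obtain h where h: "h \<in> H" "\<phi> (z [^] j) p = translate h (\<phi> (z [^] i) p)"
    using coset_class_eqD[OF _ pts pts] unfolding f_def by blast
  have "\<phi> (z [^] i) (\<phi> (z [^] (j - i)) p) = \<phi> (z [^] j) p"
    using ij z by (simp add: nat_pow_mult flip: \<phi>_mult)
  also have "\<dots> = \<phi> (z [^] i) (translate h p)"
    using h z p by (simp add: \<phi>_translate)
  finally have "\<phi> (z [^] (j - i)) p = translate h p"
    using z by (simp add: \<phi>_inject)
  moreover have "j - i dvd exponent"
    unfolding exponent_def using ij by (intro dvd_fact) auto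
  ultimately show ?thesis using ij h by (intro exI[of _ "j - i"] exI[of _ h]) auto
qed

lemma \<phi>_pow_exponent:
  assumes z: "z \<in> carrier F" and p: "p \<in> points"
  shows "\<exists>h\<in>H. \<phi> (z [^] exponent) p = translate h p"
proof -
  obtain d h where d: "d dvd exponent" "h \<in> H" "\<phi> (z [^] d) p = translate h p"
    using ex_pow_translate[OF assms] by blast
  then obtain m where m: "exponent = d * m" by blast
  have "h [^] m \<in> H" using d(2) by (rule H_pow)
  moreover have "\<phi> (z [^] exponent) p = translate (h [^] m) p"
    using \<phi>_pow_translate[of "z [^] d" p h m] d z p by (simp add: m nat_pow_pow)
  ultimately show ?thesis by blast
qed

text \<open>The kernel of the induced action on the \<open>H\<close>-orbits of points. The
  translation \<open>h\<close> may vary with the point, even within one orbit.\<close>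

definition coset_kernel :: "'a set" where
  "coset_kernel = {z \<in> carrier F. \<forall>p\<in>points. \<exists>h\<in>H. \<phi> z p = translate h p}"

lemma coset_kernel_closed [simp]: "z \<in> coset_kernel \<Longrightarrow> z \<in> carrier F"
  by (simp add: coset_kernel_def)

lemma coset_kernelE:
  assumes "z \<in> coset_kernel" "p \<in> points"
  obtains h where "h \<in> H" "\<phi> z p = translate h p"
  using assms unfolding coset_kernel_def by blast

lemma pow_exponent_in_coset_kernel: "z \<in> carrier F \<Longrightarrow> z [^] exponent \<in> coset_kernel"
  unfolding coset_kernel_def using \<phi>_pow_exponent nat_pow_closed by blast

lemma coset_kernel_mult:
  assumes "a \<in> coset_kernel" "b \<in> coset_kernel"
  shows "a \<otimes> b \<in> coset_kernel"
  unfolding coset_kernel_def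
proof (intro CollectI conjI ballI)
  interpret H: subgroup H F by (rule subgroup_H)
  fix p assume p: "p \<in> points"
  obtain h where h: "h \<in> H" "\<phi> a p = translate h p" using assms(1) p by (rule coset_kernelE)
  obtain k where k: "k \<in> H" "\<phi> b p = translate k p" using assms(2) p by (rule coset_kernelE)
  have "\<phi> (a \<otimes> b) p = translate (h \<otimes> k) p"
    using assms h k p by (simp add: \<phi>_mult \<phi>_translate translate_translate)
  then show "\<exists>h\<in>H. \<phi> (a \<otimes> b) p = translate h p" using h k by auto
qed (use assms in auto)

lemma coset_kernel_conj:
  assumes a: "a \<in> coset_kernel" and u: "u \<in> carrier F"
  shows "u \<otimes> a \<otimes> inv u \<in> coset_kernel"
  unfolding coset_kernel_def
proof (intro CollectI conjI ballI)
  fix p assume p: "p \<in> points"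
  then have "\<phi> u p \<in> points" using u by (intro \<phi>_points)
  with a obtain h where h: "h \<in> H" "\<phi> a (\<phi> u p) = translate h (\<phi> u p)" by (rule coset_kernelE)
  then have "\<phi> (u \<otimes> a \<otimes> inv u) p = translate h p"
    using a u p \<open>\<phi> u p \<in> points\<close>
    by (simp add: \<phi>_mult \<phi>_translate \<phi>_inv del: mem_Sigma_iff)
  then show "\<exists>h\<in>H. \<phi> (u \<otimes> a \<otimes> inv u) p = translate h p" using h by auto
qed (use assms in auto)

lemma coset_kernel_inv:
  assumes "a \<in> coset_kernel"
  shows "inv a \<in> coset_kernel"
  unfolding coset_kernel_def
proof (intro CollectI conjI ballI)
  interpret H: subgroup H F by (rule subgroup_H)
  fix p assume p: "p \<in> points"
  obtain h where h: "h \<in> H" "\<phi> a p = translate h p" using assms p by (rule coset_kernelE)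
  have "\<phi> a (translate (inv h) p) = p"
    using h assms p by (simp add: \<phi>_translate translate_translate translate_one)
  then have "\<phi> (inv a) p = translate (inv h) p"
    using \<phi>_inv(1)[of a "translate (inv h) p"] assms by simp
  then show "\<exists>h\<in>H. \<phi> (inv a) p = translate h p" using h by auto
qed (use assms in auto)

section \<open>Point stabilizers inside the kernel of the action on orbits\<close>

definition fixer :: "'a \<times> bool \<Rightarrow> 'a set" where
  "fixer p = {a \<in> coset_kernel. \<phi> a p = p}"

lemma fixer_translate:
  assumes "a \<in> fixer p" "p \<in> points" "h \<in> H"
  shows "\<phi> a (translate h p) = translate h p"
  using assms by (simp add: fixer_def \<phi>_translate)

text \<open>\<open>c\<close> moves \<open>p\<close> within its \<open>H\<close>-orbit, and
  \<open>a\<close> fixes that whole orbit because it commutes with translations. Thus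
  \<open>coset_kernel\<close> normalizes each stabilizer.\<close>

lemma fixer_conj:
  assumes a: "a \<in> fixer p" and c: "c \<in> coset_kernel" and p: "p \<in> points"
  shows "c \<otimes> a \<otimes> inv c \<in> fixer p"
proof -
  obtain h where h: "h \<in> H" "\<phi> c p = translate h p" using c p by (rule coset_kernelE)
  have ac: "a \<in> coset_kernel" using a by (simp add: fixer_def)
  have "\<phi> (c \<otimes> a \<otimes> inv c) p = \<phi> (inv c) (\<phi> a (\<phi> c p))"
    using c ac by (simp add: \<phi>_mult)
  also have "\<phi> a (\<phi> c p) = \<phi> c p"
    using fixer_translate[OF a p h(1)] h by simp
  finally show ?thesis
    using c ac coset_kernel_conj[of a c] by (simp add: fixer_def \<phi>_inv)
qed

lemma fixer_mult_inv:
  assumes "a \<in> fixer p" "b \<in> fixer p"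
  shows "a \<otimes> b \<in> fixer p" "inv a \<in> fixer p"
  using assms \<phi>_inv(1)[of a p]
  by (auto simp: fixer_def coset_kernel_mult coset_kernel_inv \<phi>_mult)

text \<open>A commutator is an element times a conjugate of its inverse, in either factor. So a
  commutator of elements fixing different points fixes the points of both.\<close>

lemma commutator_in_fixer:
  assumes "a \<in> fixer p \<and> b \<in> coset_kernel \<or> b \<in> fixer p \<and> a \<in> coset_kernel" and p: "p \<in> points"
  shows "(a \<otimes> b) \<otimes> inv (b \<otimes> a) \<in> fixer p"
  using assms(1)
proof
  assume *: "a \<in> fixer p \<and> b \<in> coset_kernel"
  then have "a \<in> coset_kernel" by (simp add: fixer_def)
  then have "(a \<otimes> b) \<otimes> inv (b \<otimes> a) = a \<otimes> (b \<otimes> inv a \<otimes> inv b)"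
    using * by (simp add: inv_mult_group m_assoc)
  then show ?thesis using * p fixer_mult_inv fixer_conj by metis
next
  assume *: "b \<in> fixer p \<and> a \<in> coset_kernel"
  then have "b \<in> coset_kernel" by (simp add: fixer_def)
  then have "(a \<otimes> b) \<otimes> inv (b \<otimes> a) = (a \<otimes> b \<otimes> inv a) \<otimes> inv b"
    using * by (simp add: inv_mult_group m_assoc)
  then show ?thesis using * p fixer_mult_inv fixer_conj by metis
qed

section \<open>Points at which a letter leaves \<open>Y\<close>\<close>

lemma pow_basis_fixes_exit:
  assumes g: "g \<in> Y" and x: "x \<in> B" and y: "y = x \<or> y = inv x" and exit: "g \<otimes> y \<notin> Y"
  shows "\<phi> (x [^] exponent) (g, s) = (g, s)"
proof -
  interpret H: subgroup H F by (rule subgroup_H)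
  have yc [simp]: "y \<in> carrier F" using x y by auto
  have gc [simp]: "g \<in> carrier F" using g by simp
  define v where "v j = g \<otimes> inv y [^] j" for j :: nat
  have v0: "v 0 = g" by (simp add: v_def)
  have v_back: "v j \<otimes> inv y = v (Suc j)" for j
    by (simp add: v_def m_assoc)
  have v_fwd: "v (Suc j) \<otimes> y = v j" for j
    by (simp add: v_def m_assoc)
  \<comment> \<open>The orbit of \<open>(g, s)\<close> never gets past the exit at \<open>g\<close>, so it stays on the finite path
    \<open>v 0, v 1, \<dots>\<close> leading back from \<open>g\<close> inside \<open>Y\<close>.\<close>
  define T where "T = {(v j, s) | j (s :: bool). \<forall>i\<le>j. v i \<in> Y}"
  have T_shift: "shift F Y x p \<in> T" if pT: "p \<in> T" for p
  proof -
    obtain j s where p: "p = (v j, s)" "\<forall>i\<le>j. v i \<in> Y" using pT by (auto simp: T_def)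
    then have vj: "v j \<in> Y" by simp
    have stay: "(v j, t) \<in> T" for t using p by (auto simp: T_def)
    \<comment> \<open>On sheet \<open>s\<close> the shift runs along the path either towards the
      exit or away from it. At the exit, and at a far end if there is one, it changes the
      sheet.\<close>
    have y_x: "(if s then x else inv x) = y \<or> (if s then x else inv x) = inv y"
      using x y by auto
    then show ?thesis
    proof
      assume eq: "(if s then x else inv x) = y"
      show ?thesis
      proof (cases j)
        case 0
        then show ?thesis using eq exit stay vj p by (simp add: shift_def flip_def v0)
      next
        case (Suc i)
        then have "(v i, s) \<in> T" "v i \<in> Y" using p by (auto simp: T_def)
        then show ?thesis using eq vj p Suc by (simp add: shift_def v_fwd)
      qed
    next
      assume eq: "(if s then x else inv x) = inv y"
      have "(v (Suc j), s) \<in> T" if "v (Suc j) \<in> Y"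
        unfolding T_def using p that by (auto simp: le_Suc_eq intro!: exI[of _ "Suc j"])
      then show ?thesis using eq vj p stay by (simp add: shift_def flip_def v_back Let_def)
    qed
  qed
  have gT: "(g, s) \<in> T" using g v0 by (force simp: T_def)
  have "\<phi> (x [^] n) (g, s) \<in> T" for n :: nat
    using x gT by (induction n) (auto simp: \<phi>_one \<phi>_mult \<phi>_basis T_shift)
  moreover obtain d h where d: "d dvd exponent" "h \<in> H" "\<phi> (x [^] d) (g, s) = translate h (g, s)"
    using ex_pow_translate[of x "(g, s)"] g x by auto
  ultimately have "translate h (g, s) \<in> T" by metis
  then obtain j where j: "h \<otimes> g = v j" "\<forall>i\<le>j. v i \<in> Y" by (auto simp: T_def translate_def)
  \<comment> \<open>By invariance of \<open>Y\<close> under \<open>H\<close>, the letter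
    \<open>y\<close> leaves \<open>Y\<close> at \<open>h \<otimes> g\<close> as it does at
    \<open>g\<close>. At \<open>v j\<close> with \<open>j > 0\<close> it leads to
    \<open>v (j - 1)\<close>, which lies in \<open>Y\<close>.\<close>
  have "j = 0"
  proof (cases j)
    case (Suc i)
    then have "h \<otimes> (g \<otimes> y) = v i"
      using j d v_fwd[of i] by (simp flip: m_assoc)
    moreover have "v i \<in> Y" using j Suc by simp
    ultimately show ?thesis using exit d H_Y_iff[of h "g \<otimes> y"] by simp
  qed
  then have "translate h (g, s) = (g, s)" using j by (simp add: translate_def v0)
  then have fixed: "\<phi> (x [^] d) (g, s) = translate \<one> (g, s)" using d g by (simp add: translate_def)
  obtain m where "exponent = d * m" using d by blast
  then show ?thesis
    using \<phi>_pow_translate[OF _ _ _ fixed, of m] g x by (simp add: nat_pow_pow translate_def)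
qed

text \<open>On the negative sheet the inverse letters are applied, so both sheets reach the exit.\<close>

lemma ex_exit:
  assumes "z \<in> carrier F" "g \<in> Y" "g \<otimes> z \<notin> Y"
  shows "\<exists>u\<in>carrier F. \<exists>x\<in>B. \<phi> (x [^] exponent) (\<phi> u (g, s)) = \<phi> u (g, s)"
proof -
  \<comment> \<open>The letters of \<open>z\<close> are followed from \<open>g\<close> until the
    first one that leaves \<open>Y\<close>; \<open>u\<close> collects the group elements that act as
    these moves on sheet \<open>s\<close>.\<close>
  have step: "\<exists>u\<in>carrier F. \<exists>x\<in>B. \<phi> (x [^] exponent) (\<phi> u (g, s)) = \<phi> u (g, s)"
    if x: "x \<in> B" and z: "z \<in> carrier F" and g: "g \<in> Y" and y: "y = x \<or> y = inv x"
      and exit: "g \<otimes> (y \<otimes> z) \<notin> Y"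
      and IH: "\<And>g. g \<in> Y \<Longrightarrow> g \<otimes> z \<notin> Y \<Longrightarrow>
        \<exists>u\<in>carrier F. \<exists>x\<in>B. \<phi> (x [^] exponent) (\<phi> u (g, s)) = \<phi> u (g, s)"
    for x y z g
  proof (cases "g \<otimes> y \<in> Y")
    case False
    with pow_basis_fixes_exit[OF g x y] x show ?thesis
      by (intro bexI[of _ \<one>] bexI[of _ x]) (auto simp: \<phi>_one)
  next
    case True
    have yc: "y \<in> carrier F" using x y by auto
    then obtain u x' where u: "u \<in> carrier F" "x' \<in> B"
      "\<phi> (x' [^] exponent) (\<phi> u (g \<otimes> y, s)) = \<phi> u (g \<otimes> y, s)"
      using IH[of "g \<otimes> y"] True exit z g by (auto simp: m_assoc)
    define t where "t = (if s then y else inv y)"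
    have "t = x \<or> t = inv x" using x y by (auto simp: t_def)
    then have "\<phi> t (g, s) = (g \<otimes> y, s)"
      using x y g True by (auto simp: \<phi>_basis \<phi>_inv_basis shift_def flip_def t_def split: if_splits)
    then show ?thesis
      using u yc by (intro bexI[of _ "t \<otimes> u"] bexI[of _ x']) (auto simp: \<phi>_mult t_def)
  qed
  show ?thesis
    using assms
  proof (induction z arbitrary: g rule: basis_induct)
    case one
    then show ?case by simp
  next
    case (gen x z)
    then show ?case using step[of x z g x] by blast
  next
    case (inv x z)
    then show ?case using step[of x z g "inv x"] by blast
  qed
qed

lemma ex_not_in_Y: "\<exists>z\<in>carrier F. z \<notin> Y"
proof (rule ccontr)
  assume "\<not> ?thesis"
  then have "rcosets H \<subseteq> (#>) H ` Y" by (auto simp: RCOSETS_def)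
  with finite_cosets infinite_index show False using finite_subset by blast
qed

section \<open>Nontrivial elements fixing all points\<close>

lemma ex_conj_pow_in_fixer:
  assumes "p \<in> points"
  shows "\<exists>u\<in>carrier F. \<exists>x\<in>B. u \<otimes> x [^] exponent \<otimes> inv u \<in> fixer p"
proof -
  obtain g s where p: "p = (g, s)" "g \<in> Y" using assms by auto
  obtain z where z: "z \<in> carrier F" "z \<notin> Y" using ex_not_in_Y by blast
  then obtain u x where u: "u \<in> carrier F" "x \<in> B"
    "\<phi> (x [^] exponent) (\<phi> u (g, s)) = \<phi> u (g, s)"
    using ex_exit[of "inv g \<otimes> z" g s] p by (auto simp: inv_mult_cancel_left)
  then show ?thesis unfolding p
    by (intro bexI[of _ u] bexI[of _ x])
       (auto simp: fixer_def \<phi>_mult \<phi>_inv intro!: coset_kernel_conj pow_exponent_in_coset_kernel)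
qed

text \<open>In rank one \<open>F\<close> is commutative, so conjugation has no effect and one power
  \<open>x^exponent\<close> fixes every point of \<open>T\<close>. In higher rank induction on
  \<open>T\<close> takes the commutator of an element fixing the old points and one fixing the new
  point, once conjugation has made them noncommuting.\<close>

lemma ex_fixer_nontrivial:
  assumes "finite T" "T \<subseteq> points" "B \<noteq> {}"
  shows "\<exists>a\<in>coset_kernel. a \<noteq> \<one> \<and> (\<forall>p\<in>T. a \<in> fixer p)"
proof (cases "\<exists>x\<in>B. \<exists>y\<in>B. x \<noteq> y")
  case False
  with \<open>B \<noteq> {}\<close> obtain x where x: "B = {x}" by blast
  then have xB: "x \<in> B" by simp
  have pos: "exponent > 0" by (simp add: exponent_def)
  have comm: "u \<otimes> x = x \<otimes> u" if "u \<in> carrier F" for u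
    using that
  proof (induction rule: basis_induct)
    case (gen y z)
    then show ?case using x by (simp add: m_assoc)
  next
    case (inv y z)
    then show ?case using x xB by (simp add: m_assoc inv_mult_cancel_left)
  qed (use xB in simp)
  have comm_pow: "u \<otimes> x [^] n \<otimes> inv u = x [^] n" if "u \<in> carrier F" for u and n :: nat
    using that xB comm by (metis basis_closed group_commutes_pow nat_pow_closed inv_solve_right m_closed)
  have "x [^] exponent \<in> fixer p" if p: "p \<in> T" for p
    using ex_conj_pow_in_fixer[of p] p assms(2) x comm_pow by auto
  then show ?thesis
    using xB pow_basis_neq_one[OF xB pos]
    by (intro bexI[of _ "x [^] exponent"]) (auto intro: pow_exponent_in_coset_kernel)
next
  case True
  then obtain x y where xy: "x \<in> B" "y \<in> B" "x \<noteq> y" by blast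
  have pos: "exponent > 0" by (simp add: exponent_def)
  show ?thesis
    using assms(1,2)
  proof (induction T rule: finite_induct)
    case empty
    show ?case using xy pow_basis_neq_one[OF xy(1) pos]
      by (intro bexI[of _ "x [^] exponent"])
       (auto intro: pow_exponent_in_coset_kernel)
  next
    case (insert p T)
    then obtain a where a: "a \<in> coset_kernel" "a \<noteq> \<one>" "\<forall>q\<in>T. a \<in> fixer q" by auto
    have p: "p \<in> points" using insert by simp
    obtain u z where u: "u \<in> carrier F" "z \<in> B" "u \<otimes> z [^] exponent \<otimes> inv u \<in> fixer p"
      using ex_conj_pow_in_fixer[OF p] by blast
    define b where "b = u \<otimes> z [^] exponent \<otimes> inv u"
    have b: "b \<in> fixer p" "b \<in> coset_kernel" using u by (auto simp: b_def fixer_def)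
    have "b \<noteq> \<one>"
    proof
      assume "b = \<one>"
      then have "u \<otimes> z [^] exponent = u" using u by (simp add: b_def inv_solve_right')
      then show False using u pow_basis_neq_one[OF u(2) pos] by (simp add: r_cancel_one)
    qed
    then obtain l m where lm: "fst l \<in> B" "fst m \<in> B"
      "(letter l [^] exponent \<otimes> a \<otimes> inv (letter l [^] exponent)) \<otimes>
         (letter m [^] exponent \<otimes> b \<otimes> inv (letter m [^] exponent)) \<noteq>
       (letter m [^] exponent \<otimes> b \<otimes> inv (letter m [^] exponent)) \<otimes>
         (letter l [^] exponent \<otimes> a \<otimes> inv (letter l [^] exponent))"
      using ex_noncommuting_conjugates[OF xy pos, of a b] a b by (metis coset_kernel_closed)
    \<comment> \<open>As powers with exponent \<open>exponent\<close>, the conjugators lie in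
      \<open>coset_kernel\<close>, so conjugating by them loses no fixed point already
      gained.\<close>
    define c d where "c = letter l [^] exponent" and "d = letter m [^] exponent"
    have cd: "c \<in> coset_kernel" "d \<in> coset_kernel"
      using lm by (auto simp: c_def d_def intro: pow_exponent_in_coset_kernel)
    define a' b' where "a' = c \<otimes> a \<otimes> inv c" and "b' = d \<otimes> b \<otimes> inv d"
    have neq: "a' \<otimes> b' \<noteq> b' \<otimes> a'" using lm by (simp add: a'_def b'_def c_def d_def)
    have a': "a' \<in> coset_kernel" "\<forall>q\<in>T. a' \<in> fixer q"
      using a cd insert.prems by (auto simp: a'_def intro: coset_kernel_conj fixer_conj)
    have b': "b' \<in> coset_kernel" "b' \<in> fixer p"
      using b cd p by (auto simp: b'_def intro: coset_kernel_conj fixer_conj)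
    let ?k = "(a' \<otimes> b') \<otimes> inv (b' \<otimes> a')"
    have "?k \<noteq> \<one>"
      using neq a' b' by (simp add: inv_solve_right')
    moreover have "?k \<in> fixer q" if "q \<in> insert p T" for q
      using that a' b' insert.prems by (intro commutator_in_fixer) auto
    moreover have "?k \<in> coset_kernel"
      using a' b' by (intro coset_kernel_mult coset_kernel_inv)
    ultimately show ?case by blast
  qed
qed

lemma \<phi>_outside: "z \<in> carrier F \<Longrightarrow> p \<notin> points \<Longrightarrow> \<phi> z p = p"
proof (induction z arbitrary: p rule: basis_induct)
  case (inv x z)
  then show ?case by (cases p) (simp add: \<phi>_mult \<phi>_inv_basis shift_def flip_def)
next
  case (gen x z)
  then show ?case by (cases p) (simp add: \<phi>_mult \<phi>_basis shift_def)
qed (simp add: \<phi>_one)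

text \<open>It suffices to fix one representative of each of the finitely many
  \<open>H\<close>-orbits, because an element fixing a point fixes all its translates.\<close>

lemma kernel_nontrivial:
  assumes "B \<noteq> {}"
  shows "\<exists>a\<in>kernel F perm_group \<phi>. a \<noteq> \<one>"
proof -
  obtain T where T: "T \<subseteq> points" "finite T" "coset_class ` T = coset_class ` points"
    using finite_coset_classes by (metis finite_subset_image subset_refl)
  obtain a where a: "a \<in> coset_kernel" "a \<noteq> \<one>" "\<forall>p\<in>T. a \<in> fixer p"
    using ex_fixer_nontrivial[OF T(2,1) assms] by blast
  have "\<phi> a p = p" for p
  proof (cases "p \<in> points")
    case True
    then obtain q where q: "q \<in> T" "coset_class q = coset_class p" using T(3) by (metis imageE imageI)
    then obtain h where "h \<in> H" "p = translate h q" using coset_class_eqD[of q p] T True by blast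
    then show ?thesis using fixer_translate[of a q h] a q T by blast
  qed (use a \<phi>_outside in simp)
  then have "\<phi> a = \<one>\<^bsub>perm_group\<^esub>" by (auto simp: perm_group_def)
  then show ?thesis using a by (intro bexI[of _ a]) (auto simp: kernel_def)
qed

text \<open>While all prefixes stay in \<open>Y\<close>, the sheet never changes and the action is
  plain right multiplication.\<close>

lemma \<phi>_word:
  assumes "fst ` set w \<subseteq> B" "g \<in> carrier F" "\<And>i. i \<le> length w \<Longrightarrow> g \<otimes> word_eval F (take i w) \<in> Y"
  shows "\<phi> (word_eval F w) (g, True) = (g \<otimes> word_eval F w, True)"
  using assms
proof (induction w arbitrary: g)
  case Nil
  then show ?case by (simp add: \<phi>_one)
next
  case (Cons l w)
  obtain x s where l: "l = (x, s)" by force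
  have x: "x \<in> B" using Cons.prems l by auto
  define t where "t = (if s then x else inv x)"
  have t: "t \<in> carrier F" "word_eval F (l # v) = t \<otimes> word_eval F v" for v
    using x l by (auto simp: t_def)
  have sub: "fst ` set (take i w) \<subseteq> carrier F" for i
    using Cons.prems(1) basis_subset set_take_subset[of i w] by fastforce
  then have tc: "word_eval F (take i w) \<in> carrier F" for i by (rule word_eval_closed)
  have wc: "word_eval F w \<in> carrier F" using tc[of "length w"] by simp
  have gY: "g \<in> Y" "g \<otimes> t \<in> Y"
    using Cons.prems(2) Cons.prems(3)[of 0] Cons.prems(3)[of 1] t by simp_all
  have "\<phi> t (g, True) = (g \<otimes> t, True)"
    using gY x by (auto simp: t_def \<phi>_basis \<phi>_inv_basis shift_def flip_def)
  moreover have "\<phi> (word_eval F w) (g \<otimes> t, True) = (g \<otimes> t \<otimes> word_eval F w, True)"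
  proof (rule Cons.IH)
    fix i assume "i \<le> length w"
    then show "g \<otimes> t \<otimes> word_eval F (take i w) \<in> Y"
      using Cons.prems(2) Cons.prems(3)[of "Suc i"] t tc[of i] by (simp add: m_assoc)
  qed (use Cons.prems t in auto)
  ultimately show ?case
    using t wc Cons.prems by (simp add: \<phi>_mult m_assoc)
qed

end

section \<open>The choice of \<open>Y\<close> and the resulting normal subgroup\<close>

lemma (in free_group_on) ex_normal_trivial_intersection:
  assumes fg: "finitely_generated_subgroup H F" and inf: "infinite (rcosets H)"
  shows "\<exists>N. N \<lhd> F \<and> N \<noteq> {\<one>} \<and> N \<inter> H = {\<one>}"
proof -
  from fg obtain S where H: "subgroup H F" and S: "finite S" "S \<subseteq> carrier F" "H = generate F S"
    by (auto simp: finitely_generated_subgroup_def)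
  interpret H: subgroup H F by (rule H)
  have "\<forall>s\<in>S. \<exists>w. w \<in> reduced_words B \<and> word_eval F w = s" using S(2) obtain_word by blast
  then obtain w where w: "\<And>s. s \<in> S \<Longrightarrow> w s \<in> reduced_words B" "\<And>s. s \<in> S \<Longrightarrow> word_eval F (w s) = s"
    by metis
  \<comment> \<open>All prefixes of the chosen words are included, the empty and the full one too,
    as \<open>\<phi>_word\<close> requires for paths starting anywhere in \<open>H\<close>.\<close>
  define Q where "Q = (\<Union>s\<in>S. (\<lambda>i. word_eval F (take i (w s))) ` {..length (w s)})"
  define Y where "Y = (\<Union>q\<in>Q. H #> q)"
  have w_sub: "fst ` set (take i (w s)) \<subseteq> carrier F" if "s \<in> S" for i s
    using w(1)[OF that] basis_subset set_take_subset[of i "w s"] by (fastforce simp: reduced_words_def)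
  have Q: "finite Q" "Q \<subseteq> carrier F"
    using S(1) word_eval_closed[OF w_sub] by (auto simp: Q_def)
  have Y_sub: "Y \<subseteq> carrier F"
    unfolding Y_def using Q(2) H.subset by (intro UN_least r_coset_subset_G) auto
  have Y_I: "h \<otimes> q \<in> Y" if "h \<in> H" "q \<in> Q" for h q
    using that by (auto simp: Y_def r_coset_def)
  have H_Y: "h \<otimes> g \<in> Y" if hg: "h \<in> H" "g \<in> Y" for h g
  proof -
    from hg(2) obtain k q where "k \<in> H" "q \<in> Q" "g = k \<otimes> q" by (auto simp: Y_def r_coset_def)
    then show ?thesis using hg(1) Q(2) Y_I[of "h \<otimes> k" q] by (auto simp: m_assoc)
  qed
  have "(#>) H ` Y \<subseteq> (#>) H ` Q"
    unfolding Y_def using Q(2) repr_independence[OF _ _ H] by blast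
  then have fin: "finite ((#>) H ` Y)" using Q(1) finite_subset by blast
  have "shift F Y \<in> B \<rightarrow> carrier perm_group"
    using bij_shift[OF Y_sub] by (simp add: perm_group_def)
  then obtain \<phi> where \<phi>: "\<phi> \<in> hom F perm_group" "\<forall>x\<in>B. \<phi> x = shift F Y x"
    using universal_property[OF group_perm_group] by blast
  interpret coset_action F B H Y \<phi>
    by unfold_locales (use H Y_sub H_Y fin inf \<phi> in auto)
  let ?N = "kernel F perm_group \<phi>"
  interpret hom: group_hom F perm_group \<phi>
    using \<phi>(1) by (simp add: group_hom_def group_hom_axioms_def is_group group_perm_group)
  \<comment> \<open>An empty basis would make \<open>F\<close> trivial and the index finite.\<close>
  have "B \<noteq> {}"
  proof
    assume "B = {}"
    then have "carrier F \<subseteq> {\<one>}" using basis_induct[of _ "\<lambda>z. z = \<one>"] by blast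
    then have "rcosets H \<subseteq> {H #> \<one>}" by (auto simp: RCOSETS_def)
    with inf show False using finite_subset by blast
  qed
  then obtain a where "a \<in> ?N" "a \<noteq> \<one>" using kernel_nontrivial by blast
  then have "?N \<noteq> {\<one>}" by blast
  moreover have "?N \<inter> H = {\<one>}"
  proof -
    \<comment> \<open>The start \<open>g\<close> ranges over \<open>H\<close>, so that the paths of
      successive generators can be joined.\<close>
    have act_H: "\<phi> h (g, True) = (g \<otimes> h, True)" if "h \<in> generate F S" "g \<in> H" for h g
      using that
    proof (induction arbitrary: g rule: generate.induct)
      case (incl s)
      have prefix_in_Y: "g \<otimes> word_eval F (take i (w s)) \<in> Y" if "i \<le> length (w s)" for i
        using incl that by (intro Y_I) (auto simp: Q_def)
      have "fst ` set (w s) \<subseteq> B" using w(1)[OF incl(1)] by (simp add: reduced_words_def)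
      then show ?case using \<phi>_word[of "w s" g] w(2) prefix_in_Y incl by simp
    next
      case (inv s)
      have s: "s \<in> carrier F" "s \<in> H" using inv(1) S by (auto intro: generate.incl)
      \<comment> \<open>For an inverse generator the word of \<open>s\<close> is followed from
        \<open>g \<otimes> inv s\<close> up to \<open>g\<close>, and the resulting equation is then
        inverted.\<close>
      have gs: "g \<otimes> inv s \<in> H" using inv s by simp
      have prefix_in_Y: "(g \<otimes> inv s) \<otimes> word_eval F (take i (w s)) \<in> Y" if "i \<le> length (w s)" for i
        using inv(1) gs that by (intro Y_I) (auto simp: Q_def)
      have "fst ` set (w s) \<subseteq> B" using w(1)[OF inv(1)] by (simp add: reduced_words_def)
      then have "\<phi> s (g \<otimes> inv s, True) = (g, True)"
        using \<phi>_word[of "w s" "g \<otimes> inv s"] w(2) prefix_in_Y inv s by (simp add: m_assoc)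
      then show ?case using \<phi>_inv(1)[OF s(1), of "(g \<otimes> inv s, True)"] by simp
    next
      case (eng h k)
      then have "h \<in> H" "k \<in> H" using S(3) by simp_all
      with eng show ?case by (simp add: \<phi>_mult m_assoc del: hom.hom_mult)
    qed (simp add: perm_group_def)
    \<comment> \<open>An element of the kernel fixes \<open>(\<one>, True)\<close>, whereas
      \<open>h\<close> in \<open>H\<close> sends it to \<open>(h, True)\<close>.\<close>
    have "h = \<one>" if "h \<in> ?N" "h \<in> H" for h
      using act_H[of h \<one>] that S(3) H.one_closed by (simp add: kernel_def perm_group_def)
    then show ?thesis using hom.subgroup_kernel subgroup.one_closed by fastforce
  qed
  ultimately show ?thesis using hom.normal_kernel by blast
qed

theorem mainTheorem1:
  fixes F :: "('a, 'b) monoid_scheme" and H :: "'a set"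
  assumes "free_group F"
    and "finitely_generated_subgroup H F"
    and "infinite (rcosets\<^bsub>F\<^esub> H)"
  shows "\<exists>N. N \<lhd> F \<and> N \<noteq> {\<one>\<^bsub>F\<^esub>} \<and> N \<inter> H = {\<one>\<^bsub>F\<^esub>}"
proof -
  obtain B where "group F" "free_basis F B" using assms(1) by (auto simp: free_group_def)
  then interpret free_group_on F B by (simp add: free_group_on_def free_group_on_axioms_def)
  show ?thesis using ex_normal_trivial_intersection assms(2,3) .
qed

end
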